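(* Let $\mathcal{T}$ be the rooted tree whose vertices are all strong-Baxter permutations of size $\geq 1$, whose root is the permutation $1$ of size $1$, and in which the children of a strong-Baxter permutation $\pi$ of size $n$ are exactly the permutations $\pi\cdot a$, $a\in\{1,\dots,n+1\}$, that are strong-Baxter. Then $\mathcal{T}$ is a generating tree for strong-Baxter permutations (every strong-Baxter permutation of size $n$ appears exactly once, at level $n$), and $\mathcal{T}$ is isomorphic (as a rooted tree) to the tree generated by the succession rule $$\Omega_{strong}=\left\{\begin{array}{l}(1,1)\\ (h,k)\rightsquigarrow (1,k),\dots,(h-1,k),(h,k+1),\\ \phantom{(h,k)\rightsquigarrow{}}(h+1,1),\dots,(h+1,k).\end{array}\right.$$
   Context: A permutation $\pi=\pi_1\cdots\pi_n$ of $\{1,\dots,n\}$ is strong-Baxter if there are no indices $i<j$ and $k>j+1$ satisfying any of the following: $\pi_{j+1}<\pi_i<\pi_k<\pi_j$ (vincular pattern $2413$ with $4,1$ adjacent); $\pi_j<\pi_k<\pi_i<\pi_{j+1}$ (vincular pattern $3142$ with $1,4$ adjacent); $\pi_{j+1}<\pi_k<\pi_i<\pi_j$ (vincular pattern $3412$ with $4,1$ adjacent). For a permutation $\pi$ of size $n$ and $a\in\{1,\dots,n+1\}$, $\pi\cdot a$ (insertion of $a$ on the right) is the permutation $\pi'$ of size $n+1$ with $\pi'_{n+1}=a$ and, for $i\leq n$, $\pi'_i=\pi_i$ if $\pi_i<a$ and $\pi'_i=\pi_i+1$ if $\pi_i\geq a$. A generating tree for a class of objects is an infinite rooted tree whose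 vertices are the objects, each appearing exactly once, objects of size $n$ being at level $n$ (the root is at level $1$). A succession rule consists of a root label and productions $\ell\rightsquigarrow \ell_1,\dots,\ell_m$; the tree it generates is the rooted tree with labelled nodes in which the root has the root label and every node labelled $\ell$ has $m$ children labelled $\ell_1,\dots,\ell_m$. In $\Omega_{strong}$, a node labelled $(h,k)$ has the $h-1$ children $(i,k)$, $1\leq i\leq h-1$, the child $(h,k+1)$, and the $k$ children $(h+1,i)$, $1\leq i\leq k$. *)

theory Defs
  imports "HOL-Combinatorics.Multiset_Permutations"
begin

text \<open>
  A permutation of \<open>{1..n}\<close> is a word, i.e. an element of
  \<^term>\<open>permutations_of_set {1..n::nat}\<close>. List positions count from 0, so the entry
  \<open>\<pi>\<^sub>i\<close> in the usual notation is \<open>\<pi> ! (i - 1)\<close>; the conditions below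
  only compare positions with each other and do not depend on this shift.
\<close>

definition avoids_2_41_3 :: "nat list \<Rightarrow> bool" where
  "avoids_2_41_3 \<pi> \<longleftrightarrow>
     \<not> (\<exists>i j k. i < j \<and> j + 1 < k \<and> k < length \<pi> \<and>
          \<pi> ! (j + 1) < \<pi> ! i \<and> \<pi> ! i < \<pi> ! k \<and> \<pi> ! k < \<pi> ! j)"

definition avoids_3_14_2 :: "nat list \<Rightarrow> bool" where
  "avoids_3_14_2 \<pi> \<longleftrightarrow>
     \<not> (\<exists>i j k. i < j \<and> j + 1 < k \<and> k < length \<pi> \<and>
          \<pi> ! j < \<pi> ! k \<and> \<pi> ! k < \<pi> ! i \<and> \<pi> ! i < \<pi> ! (j + 1))"

definition avoids_3_41_2 :: "nat list \<Rightarrow> bool" where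
  "avoids_3_41_2 \<pi> \<longleftrightarrow>
     \<not> (\<exists>i j k. i < j \<and> j + 1 < k \<and> k < length \<pi> \<and>
          \<pi> ! (j + 1) < \<pi> ! k \<and> \<pi> ! k < \<pi> ! i \<and> \<pi> ! i < \<pi> ! j)"

definition strong_Baxter :: "nat \<Rightarrow> nat list set" where
  "strong_Baxter n =
     {\<pi> \<in> permutations_of_set {1..n}.
        avoids_2_41_3 \<pi> \<and> avoids_3_14_2 \<pi> \<and> avoids_3_41_2 \<pi>}"

definition insert_right :: "nat list \<Rightarrow> nat \<Rightarrow> nat list" (infixl "\<cdot>" 70) where
  "\<pi> \<cdot> a = map (\<lambda>x. if x < a then x else x + 1) \<pi> @ [a]"

text \<open>\<open>edges T\<close> consists of the pairs (parent, child).\<close>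

record 'v rtree =
  verts :: "'v set"
  rt :: 'v
  edges :: "('v \<times> 'v) set"

definition rooted_tree :: "'v rtree \<Rightarrow> bool" where
  "rooted_tree T \<longleftrightarrow>
     rt T \<in> verts T \<and>
     edges T \<subseteq> verts T \<times> verts T \<and>
     (\<forall>u. (u, rt T) \<notin> edges T) \<and>
     (\<forall>v \<in> verts T - {rt T}. \<exists>!u. (u, v) \<in> edges T) \<and>
     (\<forall>v \<in> verts T. (rt T, v) \<in> (edges T)\<^sup>*)"

text \<open>The root is at level 1, and level 0 is empty.\<close>

definition level :: "'v rtree \<Rightarrow> nat \<Rightarrow> 'v set" where
  "level T n = {v \<in> verts T. \<exists>m. n = Suc m \<and> (rt T, v) \<in> edges T ^^ m}"

definition rtree_isomorphic :: "'v rtree \<Rightarrow> 'w rtree \<Rightarrow> bool" where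
  "rtree_isomorphic S T \<longleftrightarrow>
     (\<exists>f. bij_betw f (verts S) (verts T) \<and> f (rt S) = rt T \<and>
          (\<forall>u \<in> verts S. \<forall>v \<in> verts S. (u, v) \<in> edges S \<longleftrightarrow> (f u, f v) \<in> edges T))"

text \<open>
  The class is given by its sets \<open>C n\<close> of objects of size \<open>n\<close>, for \<open>n \<ge> 1\<close>.
  Since the vertices of the tree are the objects themselves, each object appears exactly once.
\<close>

definition generating_tree :: "(nat \<Rightarrow> 'v set) \<Rightarrow> 'v rtree \<Rightarrow> bool" where
  "generating_tree C T \<longleftrightarrow>
     rooted_tree T \<and> infinite (verts T) \<and>
     verts T = (\<Union>n\<in>{1..}. C n) \<and>
     (\<forall>n\<ge>1. level T n = C n)"

text \<open>
  A rule is a root label together with the list of labels produced by each label.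
  A node of the generated tree is a pair of an address and a label: the address lists, from the
  root downwards, which child is taken at each step, so that siblings with equal labels remain
  distinct nodes.
\<close>

type_synonym 'l succession_rule = "'l \<times> ('l \<Rightarrow> 'l list)"

inductive_set rule_nodes :: "'l succession_rule \<Rightarrow> (nat list \<times> 'l) set"
  for \<Omega> :: "'l succession_rule" where
  root: "([], fst \<Omega>) \<in> rule_nodes \<Omega>"
| child: "(w, l) \<in> rule_nodes \<Omega> \<Longrightarrow> i < length (snd \<Omega> l) \<Longrightarrow>
    (w @ [i], snd \<Omega> l ! i) \<in> rule_nodes \<Omega>"

definition rule_tree :: "'l succession_rule \<Rightarrow> (nat list \<times> 'l) rtree" where
  "rule_tree \<Omega> =
     \<lparr>verts = rule_nodes \<Omega>,
      rt = ([], fst \<Omega>),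
      edges = {((w, l), (w @ [i], snd \<Omega> l ! i)) | w l i.
                 (w, l) \<in> rule_nodes \<Omega> \<and> i < length (snd \<Omega> l)}\<rparr>"

lemma rule_nodes_label_unique:
  "(w, l) \<in> rule_nodes \<Omega> \<Longrightarrow> (w, l') \<in> rule_nodes \<Omega> \<Longrightarrow> l = l'"
proof (induction w l arbitrary: l' rule: rule_nodes.induct)
  case root
  then show ?case by (cases rule: rule_nodes.cases) auto
next
  case (child w l i)
  from child.prems show ?case
    by (cases rule: rule_nodes.cases) (use child.IH in auto)
qed

lemma rooted_tree_rule_tree: "rooted_tree (rule_tree \<Omega>)"
proof -
  have reach: "(([], fst \<Omega>), (w, l)) \<in> (edges (rule_tree \<Omega>))\<^sup>*"
    if "(w, l) \<in> rule_nodes \<Omega>" for w l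
    using that
  proof (induction w l rule: rule_nodes.induct)
    case (child w l i)
    then have "((w, l), (w @ [i], snd \<Omega> l ! i)) \<in> edges (rule_tree \<Omega>)"
      by (auto simp: rule_tree_def)
    with child.IH show ?case by (rule rtrancl_into_rtrancl)
  qed simp
  have parent: "\<exists>!u. (u, v) \<in> edges (rule_tree \<Omega>)"
    if node: "v \<in> rule_nodes \<Omega>" and not_root: "v \<noteq> ([], fst \<Omega>)" for v
  proof -
    obtain w' l' where v: "v = (w', l')" by (cases v)
    from node obtain w l i where
      "(w, l) \<in> rule_nodes \<Omega>" "i < length (snd \<Omega> l)" "v = (w @ [i], snd \<Omega> l ! i)"
      unfolding v by (cases rule: rule_nodes.cases) (use not_root v in auto)
    then show ?thesis
      by (intro ex1I[of _ "(w, l)"])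
         (auto simp: rule_tree_def dest: rule_nodes_label_unique)
  qed
  show ?thesis
    unfolding rooted_tree_def using reach parent
    by (auto simp: rule_tree_def intro: rule_nodes.intros)
qed

definition Omega_strong :: "(nat \<times> nat) succession_rule" where
  "Omega_strong =
     ((1, 1),
      \<lambda>(h, k). map (\<lambda>i. (i, k)) [1..<h] @ [(h, k + 1)] @ map (\<lambda>i. (h + 1, i)) [1..<k + 1])"

definition strong_Baxter_tree :: "nat list rtree" where
  "strong_Baxter_tree =
     \<lparr>verts = (\<Union>n\<in>{1..}. strong_Baxter n),
      rt = [1],
      edges = {(\<pi>, \<pi> \<cdot> a) | \<pi> a n.
                 1 \<le> n \<and> \<pi> \<in> strong_Baxter n \<and> a \<in> {1..n + 1} \<and>
                 \<pi> \<cdot> a \<in> strong_Baxter (n + 1)}\<rparr>"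

end

theory Submission
  imports Defs
begin

text \<open>
  Let \<open>\<pi>\<close> be a strong-Baxter permutation with last entry \<open>p\<close>, and call \<open>a\<close> an active site of \<open>\<pi>\<close>
  if \<open>\<pi> \<cdot> a\<close> is strong-Baxter. The label of \<open>\<pi>\<close> is \<open>(h, k)\<close>, where \<open>h\<close> counts the active sites
  \<open>\<le> p\<close> and \<open>k\<close> those \<open>> p\<close>.

  An occurrence of a forbidden pattern in \<open>\<pi> \<cdot> a\<close> that is not already one in \<open>\<pi>\<close> uses \<open>a\<close> as its last
  letter. Hence a site is inactive exactly when it is blocked by a triple formed by two adjacent
  entries \<open>x, y\<close> and an entry \<open>v\<close> to their left: if \<open>x > v > y\<close> all sites in \<open>(y, x]\<close> are blocked
  (this merges two of the patterns), and if \<open>x < v < y\<close> all sites in \<open>(x, v]\<close> are blocked. Inserting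
  \<open>a\<close> keeps the old triples, up to the doubling of site \<open>a\<close> into \<open>a\<close> and \<open>a + 1\<close>, and creates one new
  adjacent pair. Since no value is missing from \<open>\<pi>\<close>, that pair blocks exactly the sites in
  \<open>(a, p + 1]\<close> if \<open>a < p\<close>, and those in \<open>(p, a - 1]\<close> if \<open>a > p\<close> (lemma \<open>blocked_insert_right\<close>). The
  labels of the children can be read off (lemma \<open>label_insert_right\<close>):
  \<^item> if \<open>a\<close> is the \<open>i\<close>-th active site from below and \<open>a < p\<close>, only the lowest \<open>i\<close> of the sites up to
    \<open>p\<close> survive and the sites above \<open>p\<close> are unaffected, which gives \<open>(i, k)\<close>;
  \<^item> \<open>a = p\<close>, which is always active, blocks nothing and doubles, which gives \<open>(h, k + 1)\<close>;
  \<^item> if \<open>a\<close> is the \<open>i\<close>-th active site from above and \<open>a > p\<close>, the sites between \<open>p\<close> and \<open>a\<close> are lost,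
    \<open>a\<close> joins the lower sites and its double \<open>a + 1\<close> stays among the upper ones, which gives
    \<open>(h + 1, i)\<close>.

  These are the productions of \<^const>\<open>Omega_strong\<close>. A rooted tree in which the children of every
  vertex carry the labels that the rule prescribes is isomorphic to the tree of the rule, by
  following addresses from the root (lemma \<open>rtree_isomorphic_rule_tree\<close>). That the permutations form a
  generating tree holds because deleting the last entry inverts right insertion and preserves
  pattern avoidance, and because the site \<open>n + 1\<close> is always active, so that no level is empty.
\<close>

section \<open>Rooted trees whose labels obey a succession rule\<close>

text \<open>
  An address is walked down from the root \<open>r\<close>, with \<open>ch v\<close> an ordering of the children of \<open>v\<close>.
\<close>

definition node_at :: "('v \<Rightarrow> 'v list) \<Rightarrow> 'v \<Rightarrow> nat list \<Rightarrow> 'v" where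
  "node_at ch r w = foldl (\<lambda>v i. ch v ! i) r w"

lemma node_at_simps [simp]:
  "node_at ch r [] = r"
  "node_at ch r (w @ [i]) = ch (node_at ch r w) ! i"
  by (simp_all add: node_at_def)

text \<open>
  If the children of each vertex are listed in the order in which the rule produces their labels,
  then reading an address of the generated tree as a path from the root of \<open>T\<close> is the wanted
  bijection: it is onto since every vertex can be reached from the root, and injective since
  parents in \<open>T\<close> are unique and siblings are listed without repetition.
\<close>

lemma rtree_isomorphic_rule_tree:
  fixes T :: "'v rtree" and \<Omega> :: "'l succession_rule" and label :: "'v \<Rightarrow> 'l"
  assumes tree: "rooted_tree T"
    and root_label: "label (rt T) = fst \<Omega>"
    and children: "\<And>v. v \<in> verts T \<Longrightarrow>
          \<exists>cs. distinct cs \<and> set cs = {c. (v, c) \<in> edges T} \<and> map label cs = snd \<Omega> (label v)"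
  shows "rtree_isomorphic T (rule_tree \<Omega>)"
proof -
  obtain ch where ch: "\<And>v. v \<in> verts T \<Longrightarrow>
      distinct (ch v) \<and> set (ch v) = {c. (v, c) \<in> edges T} \<and> map label (ch v) = snd \<Omega> (label v)"
    using children by metis
  have root: "rt T \<in> verts T" and edges: "edges T \<subseteq> verts T \<times> verts T"
    and no_parent: "\<And>u. (u, rt T) \<notin> edges T"
    and reach: "\<And>v. v \<in> verts T \<Longrightarrow> (rt T, v) \<in> (edges T)\<^sup>*"
    using tree by (auto simp: rooted_tree_def)
  have parent: "u = u'" if "(u, v) \<in> edges T" "(u', v) \<in> edges T" for u u' v
    using tree that edges no_parent unfolding rooted_tree_def by blast
  have len: "length (ch v) = length (snd \<Omega> (label v))" if "v \<in> verts T" for v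
    using ch[OF that] by (metis length_map)
  let ?g = "node_at ch (rt T)"
  have node: "?g w \<in> verts T \<and> label (?g w) = l" if "(w, l) \<in> rule_nodes \<Omega>" for w l
    using that
  proof (induction w l rule: rule_nodes.induct)
    case root
    then show ?case using \<open>rt T \<in> verts T\<close> root_label by simp
  next
    case (child w l i)
    then have i: "i < length (ch (?g w))" using len by simp
    then have "ch (?g w) ! i \<in> set (ch (?g w))" by simp
    then have "?g (w @ [i]) \<in> verts T" using ch[of "?g w"] child edges by auto
    moreover have "label (ch (?g w) ! i) = snd \<Omega> l ! i"
      using ch[of "?g w"] child i by (metis nth_map)
    ultimately show ?case by simp
  qed
  have child_edge: "(?g w, ?g (w @ [i])) \<in> edges T"
    if "(w, l) \<in> rule_nodes \<Omega>" "i < length (snd \<Omega> l)" for w l i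
    using node[OF that(1)] ch[of "?g w"] len[of "?g w"] that(2) nth_mem[of i "ch (?g w)"] by auto
  have inj: "w = w'" if "(w, l) \<in> rule_nodes \<Omega>" "(w', l') \<in> rule_nodes \<Omega>" "?g w = ?g w'"
    for w l w' l'
    using that
  proof (induction w l arbitrary: w' l' rule: rule_nodes.induct)
    case root
    from root(1) show ?case
    proof (cases rule: rule_nodes.cases)
      case (child u m j)
      then show ?thesis using child_edge[of u m j] root no_parent by simp
    qed simp
  next
    case (child w l i)
    from child.prems(1) show ?case
    proof (cases rule: rule_nodes.cases)
      case root
      then show ?thesis using child_edge[of w l i] child no_parent by simp
    next
      case C: (child u m j)
      have "(?g w, ?g (w @ [i])) \<in> edges T" "(?g u, ?g (w @ [i])) \<in> edges T"
        using child_edge child.hyps child.prems C by metis+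
      then have g: "?g w = ?g u" by (rule parent)
      with child.IH C have "w = u" by blast
      moreover from this have "l = m" using rule_nodes_label_unique child.hyps(1) C(3) by metis
      moreover have "i = j"
        using child.prems(2) C child.hyps g \<open>l = m\<close> node[OF child.hyps(1)]
          ch[of "?g w"] len[of "?g w"] by (simp add: nth_eq_iff_index_eq)
      ultimately show ?thesis using C by simp
    qed
  qed
  have surj: "\<exists>w l. (w, l) \<in> rule_nodes \<Omega> \<and> ?g w = v" if "(rt T, v) \<in> (edges T)\<^sup>*" for v
    using that
  proof (induction rule: rtrancl_induct)
    case base
    have "([], fst \<Omega>) \<in> rule_nodes \<Omega>" by (rule rule_nodes.root)
    then show ?case by (metis node_at_simps(1))
  next
    case (step u v)
    then obtain w l where w: "(w, l) \<in> rule_nodes \<Omega>" "?g w = u" by blast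
    then have u: "u \<in> verts T" "label u = l" using node by auto
    then have "v \<in> set (ch u)" using ch step.hyps by blast
    then obtain i where "i < length (ch u)" "ch u ! i = v" by (auto simp: in_set_conv_nth)
    then show ?case
      using rule_nodes.child[OF w(1), of i] w(2) u len[of u] by (metis node_at_simps(2))
  qed
  let ?G = "\<lambda>x. ?g (fst x)"
  have bij: "bij_betw ?G (rule_nodes \<Omega>) (verts T)"
    unfolding bij_betw_def
  proof
    show "inj_on ?G (rule_nodes \<Omega>)"
    proof (rule inj_onI)
      fix x y assume "x \<in> rule_nodes \<Omega>" "y \<in> rule_nodes \<Omega>" "?G x = ?G y"
      then show "x = y"
        using inj[of "fst x" "snd x" "fst y" "snd y"] rule_nodes_label_unique
        by (metis prod.collapse)
    qed
    show "?G ` rule_nodes \<Omega> = verts T"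
    proof
      show "?G ` rule_nodes \<Omega> \<subseteq> verts T" using node by auto
      show "verts T \<subseteq> ?G ` rule_nodes \<Omega>"
      proof
        fix v assume "v \<in> verts T"
        then obtain w l where "(w, l) \<in> rule_nodes \<Omega>" "?g w = v" using surj reach by blast
        then show "v \<in> ?G ` rule_nodes \<Omega>" by (intro image_eqI[of _ _ "(w, l)"]) auto
      qed
    qed
  qed
  have edge: "(x, y) \<in> edges (rule_tree \<Omega>) \<longleftrightarrow> (?G x, ?G y) \<in> edges T"
    if x: "x \<in> rule_nodes \<Omega>" and y: "y \<in> rule_nodes \<Omega>" for x y
  proof
    assume "(x, y) \<in> edges (rule_tree \<Omega>)"
    then show "(?G x, ?G y) \<in> edges T"
      using child_edge by (auto simp: rule_tree_def)
  next
    assume e: "(?G x, ?G y) \<in> edges T"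
    obtain w l where xw: "x = (w, l)" by (cases x)
    have "fst y \<noteq> []" using e no_parent by auto
    moreover have "(fst y, snd y) \<in> rule_nodes \<Omega>" using y by simp
    then have "fst y = [] \<or> (\<exists>u m j. (u, m) \<in> rule_nodes \<Omega> \<and> j < length (snd \<Omega> m) \<and>
        y = (u @ [j], snd \<Omega> m ! j))"
      by (cases rule: rule_nodes.cases) (simp, metis prod.collapse)
    ultimately obtain u m j where C: "(u, m) \<in> rule_nodes \<Omega>" "j < length (snd \<Omega> m)"
        "y = (u @ [j], snd \<Omega> m ! j)"
      by blast
    then have "?g u = ?g w" using child_edge[OF C(1,2)] e xw by (auto intro: parent)
    then have "u = w" using inj C(1) x xw by blast
    moreover from this have "m = l" using rule_nodes_label_unique C(1) x xw by metis
    ultimately show "(x, y) \<in> edges (rule_tree \<Omega>)"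
      using C xw by (auto simp: rule_tree_def)
  qed
  let ?f = "inv_into (rule_nodes \<Omega>) ?G"
  have f: "?f v \<in> rule_nodes \<Omega>" "?G (?f v) = v" if "v \<in> verts T" for v
    using that bij_betw_inv_into_right[OF bij] bij_betw_apply[OF bij_betw_inv_into[OF bij]]
    by simp_all
  have "bij_betw ?f (verts T) (rule_nodes \<Omega>)" using bij by (rule bij_betw_inv_into)
  moreover have "?f (rt T) = ([], fst \<Omega>)"
    using bij_betw_inv_into_left[OF bij rule_nodes.root] by simp
  moreover have "(u, v) \<in> edges T \<longleftrightarrow> (?f u, ?f v) \<in> edges (rule_tree \<Omega>)"
    if "u \<in> verts T" "v \<in> verts T" for u v
    using edge[of "?f u" "?f v"] f that by simp
  ultimately show ?thesis
    unfolding rtree_isomorphic_def by (intro exI[of _ ?f]) (simp add: rule_tree_def)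
qed

section \<open>Blocked sites\<close>

definition strong_avoider :: "nat list \<Rightarrow> bool" where
  "strong_avoider \<pi> \<longleftrightarrow> avoids_2_41_3 \<pi> \<and> avoids_3_14_2 \<pi> \<and> avoids_3_41_2 \<pi>"

text \<open>
  For adjacent entries \<open>x, y\<close> and an entry \<open>v\<close> to their left, these are the sites \<open>s\<close> at which a
  new last entry completes a forbidden pattern. The first disjunct covers 2-41-3 and 3-41-2 together:
  once \<open>v\<close> lies between \<open>y\<close> and \<open>x\<close>, it does not matter on which side of \<open>v\<close> the last entry falls.
  The upper bounds \<open>s \<le> x\<close> and \<open>s \<le> v\<close> are weak because entries \<open>\<ge> s\<close> are raised when \<open>s\<close> is inserted.
\<close>

definition blocks :: "nat \<Rightarrow> nat \<Rightarrow> nat \<Rightarrow> nat \<Rightarrow> bool" where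
  "blocks v x y s \<longleftrightarrow> y < s \<and> s \<le> x \<and> y < v \<and> v < x \<or> x < s \<and> s \<le> v \<and> v < y"

definition blocked :: "nat list \<Rightarrow> nat \<Rightarrow> bool" where
  "blocked \<pi> s \<longleftrightarrow>
     (\<exists>i j. i < j \<and> j + 1 < length \<pi> \<and> blocks (\<pi> ! i) (\<pi> ! j) (\<pi> ! (j + 1)) s)"

text \<open>
  Sorting the pattern occurrences by the position of their last letter makes avoidance a condition
  on prefixes. Between distinct entries the weak bounds in \<^const>\<open>blocks\<close> are strict.
\<close>

lemma strong_avoider_iff:
  assumes "distinct \<pi>"
  shows "strong_avoider \<pi> \<longleftrightarrow> (\<forall>k < length \<pi>. \<not> blocked (take k \<pi>) (\<pi> ! k))"
proof -
  have eq: "blocks (\<pi> ! i) (\<pi> ! j) (\<pi> ! (j + 1)) (\<pi> ! k) \<longleftrightarrow>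
      \<pi> ! (j + 1) < \<pi> ! i \<and> \<pi> ! i < \<pi> ! k \<and> \<pi> ! k < \<pi> ! j \<or>
      \<pi> ! j < \<pi> ! k \<and> \<pi> ! k < \<pi> ! i \<and> \<pi> ! i < \<pi> ! (j + 1) \<or>
      \<pi> ! (j + 1) < \<pi> ! k \<and> \<pi> ! k < \<pi> ! i \<and> \<pi> ! i < \<pi> ! j"
    if "i < j" "j + 1 < k" "k < length \<pi>" for i j k
  proof -
    have "\<pi> ! i \<noteq> \<pi> ! k" "\<pi> ! j \<noteq> \<pi> ! k"
      using assms that by (auto simp: nth_eq_iff_index_eq)
    then show ?thesis unfolding blocks_def by linarith
  qed
  have "strong_avoider \<pi> \<longleftrightarrow> (\<forall>i j k. i < j \<longrightarrow> j + 1 < k \<longrightarrow> k < length \<pi> \<longrightarrow>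
      \<not> (\<pi> ! (j + 1) < \<pi> ! i \<and> \<pi> ! i < \<pi> ! k \<and> \<pi> ! k < \<pi> ! j \<or>
      \<pi> ! j < \<pi> ! k \<and> \<pi> ! k < \<pi> ! i \<and> \<pi> ! i < \<pi> ! (j + 1) \<or>
      \<pi> ! (j + 1) < \<pi> ! k \<and> \<pi> ! k < \<pi> ! i \<and> \<pi> ! i < \<pi> ! j))"
    unfolding strong_avoider_def avoids_2_41_3_def avoids_3_14_2_def avoids_3_41_2_def by meson
  also have "\<dots> \<longleftrightarrow> (\<forall>i j k. i < j \<longrightarrow> j + 1 < k \<longrightarrow> k < length \<pi> \<longrightarrow>
      \<not> blocks (\<pi> ! i) (\<pi> ! j) (\<pi> ! (j + 1)) (\<pi> ! k))"
    by (simp only: eq cong: imp_cong)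
  also have "\<dots> \<longleftrightarrow> (\<forall>k < length \<pi>. \<not> blocked (take k \<pi>) (\<pi> ! k))"
    by (auto simp: blocked_def)
  finally show ?thesis .
qed

text \<open>
  Entries are relabelled by \<open>skip a\<close>, which makes room for the value \<open>a\<close>. Dually, \<open>unskip a b\<close> is the
  site of the old permutation from which the site \<open>b\<close> of the new one stems; both \<open>a\<close> and \<open>a + 1\<close>
  stem from \<open>a\<close>. The two maps form a Galois connection, see \<open>skip_less_iff\<close>.
\<close>

definition skip :: "nat \<Rightarrow> nat \<Rightarrow> nat" where
  "skip a x = (if x < a then x else x + 1)"

definition unskip :: "nat \<Rightarrow> nat \<Rightarrow> nat" where
  "unskip a b = (if b \<le> a then b else b - 1)"

lemma insert_right_skip: "\<pi> \<cdot> a = map (skip a) \<pi> @ [a]"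
  by (simp add: insert_right_def skip_def)

lemma skip_less_skip [simp]: "skip a x < skip a y \<longleftrightarrow> x < y"
  by (auto simp: skip_def)

lemma skip_eq_skip [simp]: "skip a x = skip a y \<longleftrightarrow> x = y"
  by (auto simp: skip_def)

lemma skip_neq [simp]: "skip a x \<noteq> a" "a \<noteq> skip a x"
  by (auto simp: skip_def)

lemma skip_less_iff: "skip a x < b \<longleftrightarrow> x < unskip a b"
  by (auto simp: skip_def unskip_def)

lemma unskip_skip [simp]: "unskip a (skip a x) = x"
  by (auto simp: skip_def unskip_def)

lemma unskip_self [simp]: "unskip a a = a"
  by (simp add: unskip_def)

lemma blocks_skip: "blocks (skip a v) (skip a x) (skip a y) b \<longleftrightarrow> blocks v x y (unskip a b)"
  by (simp add: blocks_def skip_less_iff flip: not_less)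

lemma blocked_map_skip: "blocked (map (skip a) \<pi>) b \<longleftrightarrow> blocked \<pi> (unskip a b)"
  by (auto simp: blocked_def blocks_skip cong: conj_cong)

lemma distinct_insert_right: "distinct (\<pi> \<cdot> a) \<longleftrightarrow> distinct \<pi>"
  by (auto simp: insert_right_skip distinct_map inj_on_def)

lemma strong_avoider_insert_right:
  assumes "distinct \<pi>"
  shows "strong_avoider (\<pi> \<cdot> a) \<longleftrightarrow> strong_avoider \<pi> \<and> \<not> blocked \<pi> a"
proof -
  have "strong_avoider (\<pi> \<cdot> a) \<longleftrightarrow>
      (\<forall>k < length (\<pi> \<cdot> a). \<not> blocked (take k (\<pi> \<cdot> a)) ((\<pi> \<cdot> a) ! k))"
    using assms by (simp add: strong_avoider_iff distinct_insert_right)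
  also have "\<dots> \<longleftrightarrow> (\<forall>k < length \<pi>. \<not> blocked (take k \<pi>) (\<pi> ! k)) \<and> \<not> blocked \<pi> a"
    by (auto simp: insert_right_skip less_Suc_eq nth_append take_map blocked_map_skip)
  finally show ?thesis using assms by (simp add: strong_avoider_iff)
qed

text \<open>
  Appending \<open>a\<close> creates the single new adjacent pair \<open>x, a\<close>.
\<close>

lemma blocked_append:
  "blocked (\<sigma> @ [x, a]) b \<longleftrightarrow> blocked (\<sigma> @ [x]) b \<or> (\<exists>v \<in> set \<sigma>. blocks v x a b)"
proof
  assume "blocked (\<sigma> @ [x, a]) b"
  then obtain i j where ij: "i < j" "j < length \<sigma> + 1"
    "blocks ((\<sigma> @ [x, a]) ! i) ((\<sigma> @ [x, a]) ! j) ((\<sigma> @ [x, a]) ! (j + 1)) b"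
    by (auto simp: blocked_def)
  show "blocked (\<sigma> @ [x]) b \<or> (\<exists>v \<in> set \<sigma>. blocks v x a b)"
  proof (cases "j = length \<sigma>")
    case True
    with ij show ?thesis by (auto simp: nth_append)
  next
    case False
    with ij have "i < j \<and> j + 1 < length (\<sigma> @ [x]) \<and>
        blocks ((\<sigma> @ [x]) ! i) ((\<sigma> @ [x]) ! j) ((\<sigma> @ [x]) ! (j + 1)) b"
      by (auto simp: nth_append less_Suc_eq split: if_splits)
    then show ?thesis unfolding blocked_def by blast
  qed
next
  assume "blocked (\<sigma> @ [x]) b \<or> (\<exists>v \<in> set \<sigma>. blocks v x a b)"
  then show "blocked (\<sigma> @ [x, a]) b"
  proof
    assume "blocked (\<sigma> @ [x]) b"
    then obtain i j where ij: "i < j" "j < length \<sigma>"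
      "blocks ((\<sigma> @ [x]) ! i) ((\<sigma> @ [x]) ! j) ((\<sigma> @ [x]) ! (j + 1)) b"
      by (auto simp: blocked_def)
    then have "i < j \<and> j + 1 < length (\<sigma> @ [x, a]) \<and>
        blocks ((\<sigma> @ [x, a]) ! i) ((\<sigma> @ [x, a]) ! j) ((\<sigma> @ [x, a]) ! (j + 1)) b"
      by (auto simp: nth_append less_Suc_eq split: if_splits)
    then show ?thesis unfolding blocked_def by blast
  next
    assume "\<exists>v \<in> set \<sigma>. blocks v x a b"
    then obtain i where "i < length \<sigma>" "blocks (\<sigma> ! i) x a b" by (auto simp: in_set_conv_nth)
    then have "i < length \<sigma> \<and> length \<sigma> + 1 < length (\<sigma> @ [x, a]) \<and>
        blocks ((\<sigma> @ [x, a]) ! i) ((\<sigma> @ [x, a]) ! length \<sigma>) ((\<sigma> @ [x, a]) ! (length \<sigma> + 1)) b"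
      by (auto simp: nth_append)
    then show ?thesis unfolding blocked_def by blast
  qed
qed

text \<open>
  The only blocked sites not inherited from \<open>\<pi>\<close> come from the adjacent pair ending in \<open>a\<close>. A blocking
  entry \<open>v\<close> for them always exists because \<open>\<pi>\<close> contains every value in \<open>{1..n}\<close>: \<open>a\<close> itself, raised to
  \<open>a + 1\<close>, if \<open>a\<close> is below the last entry, and the value \<open>b\<close> if \<open>a\<close> is above it.
\<close>

lemma blocked_insert_right:
  assumes perm: "\<pi> \<in> permutations_of_set {1..n}" and n: "1 \<le> n" and a: "a \<in> {1..n + 1}"
  shows "blocked (\<pi> \<cdot> a) b \<longleftrightarrow> blocked \<pi> (unskip a b) \<or>
     a < last \<pi> \<and> a < b \<and> b \<le> last \<pi> + 1 \<or> last \<pi> < b \<and> b < a"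
proof -
  have set: "set \<pi> = {1..n}" and dist: "distinct \<pi>"
    using perm by (auto simp: permutations_of_set_def)
  from set n have "\<pi> \<noteq> []" by auto
  then obtain \<sigma> p where \<pi>: "\<pi> = \<sigma> @ [p]" by (metis rev_exhaust)
  have \<sigma>: "set \<sigma> = {1..n} - {p}" and p: "p \<in> {1..n}" using set dist \<pi> by auto
  have "blocked (\<pi> \<cdot> a) b \<longleftrightarrow>
      blocked (map (skip a) \<pi>) b \<or> (\<exists>v \<in> set \<sigma>. blocks (skip a v) (skip a p) a b)"
    using blocked_append[of "map (skip a) \<sigma>" "skip a p" a b]
    by (simp add: \<pi> insert_right_skip)
  moreover have "(\<exists>v \<in> set \<sigma>. blocks (skip a v) (skip a p) a b) \<longleftrightarrow>
      a < p \<and> a < b \<and> b \<le> p + 1 \<or> p < b \<and> b < a"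
  proof
    assume "\<exists>v \<in> set \<sigma>. blocks (skip a v) (skip a p) a b"
    then show "a < p \<and> a < b \<and> b \<le> p + 1 \<or> p < b \<and> b < a"
      by (auto simp: blocks_def skip_def split: if_splits)
  next
    assume "a < p \<and> a < b \<and> b \<le> p + 1 \<or> p < b \<and> b < a"
    then show "\<exists>v \<in> set \<sigma>. blocks (skip a v) (skip a p) a b"
    proof
      assume "a < p \<and> a < b \<and> b \<le> p + 1"
      then show ?thesis
        using \<sigma> a p by (intro bexI[of _ a]) (auto simp: blocks_def skip_def)
    next
      assume "p < b \<and> b < a"
      then show ?thesis
        using \<sigma> a p by (intro bexI[of _ b]) (auto simp: blocks_def skip_def)
    qed
  qed
  moreover have "last \<pi> = p" by (simp add: \<pi>)
  ultimately show ?thesis by (simp only: blocked_map_skip)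
qed

section \<open>Growth of strong-Baxter permutations by right insertion\<close>

definition sites :: "nat list \<Rightarrow> nat set" where
  "sites \<pi> = {s \<in> {1..length \<pi> + 1}. \<not> blocked \<pi> s}"

lemma finite_sites [simp]: "finite (sites \<pi>)"
  by (simp add: sites_def)

lemma strong_Baxter_iff:
  "\<pi> \<in> strong_Baxter n \<longleftrightarrow> \<pi> \<in> permutations_of_set {1..n} \<and> strong_avoider \<pi>"
  by (simp add: strong_Baxter_def strong_avoider_def)

lemma length_strong_Baxter: "\<pi> \<in> strong_Baxter n \<Longrightarrow> length \<pi> = n"
  by (auto simp: strong_Baxter_iff dest: length_finite_permutations_of_set)

lemma skip_image:
  assumes "a \<in> {1..n + 1}"
  shows "skip a ` {1..n} = {1..n + 1} - {a}"
proof
  show "skip a ` {1..n} \<subseteq> {1..n + 1} - {a}"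
    using assms by (auto simp: skip_def)
  show "{1..n + 1} - {a} \<subseteq> skip a ` {1..n}"
  proof
    fix y assume y: "y \<in> {1..n + 1} - {a}"
    then have "y = skip a (unskip a y)" "unskip a y \<in> {1..n}"
      using assms by (auto simp: skip_def unskip_def)
    then show "y \<in> skip a ` {1..n}" by blast
  qed
qed

lemma insert_right_permutation_iff:
  assumes "a \<in> {1..n + 1}"
  shows "\<pi> \<cdot> a \<in> permutations_of_set {1..n + 1} \<longleftrightarrow> \<pi> \<in> permutations_of_set {1..n}"
proof -
  have "set (\<pi> \<cdot> a) = {1..n + 1} \<longleftrightarrow> skip a ` set \<pi> = {1..n + 1} - {a}"
    using assms by (auto simp: insert_right_skip)
  also have "\<dots> \<longleftrightarrow> skip a ` set \<pi> = skip a ` {1..n}"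
    by (simp only: skip_image[OF assms])
  also have "\<dots> \<longleftrightarrow> set \<pi> = {1..n}"
    by (intro inj_image_eq_iff injI) simp
  finally show ?thesis
    by (simp add: permutations_of_set_def distinct_insert_right)
qed

lemma insert_right_strong_Baxter_iff:
  assumes "a \<in> {1..n + 1}"
  shows "\<pi> \<cdot> a \<in> strong_Baxter (n + 1) \<longleftrightarrow> \<pi> \<in> strong_Baxter n \<and> a \<in> sites \<pi>"
proof (cases "\<pi> \<in> permutations_of_set {1..n}")
  case True
  then have "distinct \<pi>" "length \<pi> = n"
    using length_finite_permutations_of_set[OF True] by (simp_all add: permutations_of_set_def)
  then show ?thesis
    using assms strong_avoider_insert_right[of \<pi> a] insert_right_permutation_iff[OF assms, of \<pi>]
    by (auto simp: strong_Baxter_iff sites_def)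
next
  case False
  then show ?thesis
    using insert_right_permutation_iff[OF assms, of \<pi>] by (simp add: strong_Baxter_iff)
qed

lemma insert_right_inject [simp]: "\<pi> \<cdot> a = \<rho> \<cdot> b \<longleftrightarrow> \<pi> = \<rho> \<and> a = b"
  by (auto simp: insert_right_skip inj_map_eq_map inj_def)

text \<open>
  Deleting the last entry and standardising undoes right insertion.
\<close>

lemma insert_right_cases:
  assumes "\<pi> \<in> strong_Baxter (n + 1)"
  obtains \<rho> a where "\<pi> = \<rho> \<cdot> a" "\<rho> \<in> strong_Baxter n" "a \<in> {1..n + 1}" "a \<in> sites \<rho>"
proof -
  have set: "set \<pi> = {1..n + 1}" and dist: "distinct \<pi>"
    using assms by (auto simp: strong_Baxter_iff permutations_of_set_def)
  from set have "\<pi> \<noteq> []" by auto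
  then obtain \<sigma> a where \<pi>: "\<pi> = \<sigma> @ [a]" by (metis rev_exhaust)
  have "skip a (unskip a x) = x" if "x \<in> set \<sigma>" for x
    using that dist \<pi> by (auto simp: skip_def unskip_def)
  then have eq: "\<pi> = map (unskip a) \<sigma> \<cdot> a"
    by (simp add: \<pi> insert_right_skip map_idI)
  moreover have "a \<in> {1..n + 1}" using set \<pi> by auto
  ultimately show thesis
    using that assms insert_right_strong_Baxter_iff by blast
qed

text \<open>
  A blocking triple contains an entry at least as large as the site that it blocks.
\<close>

lemma top_site:
  assumes "\<pi> \<in> strong_Baxter n"
  shows "n + 1 \<in> sites \<pi>"
proof -
  have len: "length \<pi> = n" using assms by (rule length_strong_Baxter)
  have le: "\<pi> ! i \<le> n" if "i < n" for i
    using assms that len nth_mem[of i \<pi>] by (auto simp: strong_Baxter_iff permutations_of_set_def)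
  have "\<not> blocks (\<pi> ! i) (\<pi> ! j) (\<pi> ! (j + 1)) (n + 1)" if "i < j" "j + 1 < n" for i j
    using le[of i] le[of j] that by (simp add: blocks_def)
  then have "\<not> blocked \<pi> (n + 1)" using len by (simp add: blocked_def)
  then show ?thesis using len by (simp add: sites_def)
qed

text \<open>
  The last entry \<open>a\<close> was itself inserted at an active site, which stays active: the pair created by
  its insertion only blocks sites different from \<open>a\<close>.
\<close>

lemma last_site:
  assumes "\<pi> \<in> strong_Baxter n" "1 \<le> n"
  shows "last \<pi> \<in> sites \<pi>"
proof -
  obtain m where m: "n = m + 1" using assms(2) by (metis add.commute le_Suc_ex)
  then obtain \<rho> a where \<pi>: "\<pi> = \<rho> \<cdot> a" and a: "a \<in> {1..m + 1}" "a \<in> sites \<rho>"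
      and \<rho>: "\<rho> \<in> strong_Baxter m"
    using assms(1) insert_right_cases by metis
  have nb: "\<not> blocked \<rho> a" using a by (simp add: sites_def)
  have "\<not> blocked \<pi> a"
  proof (cases "m = 0")
    case True
    then show ?thesis using length_strong_Baxter[OF assms(1)] m by (simp add: blocked_def)
  next
    case False
    then show ?thesis
      using nb blocked_insert_right[of \<rho> m a a] a \<rho> \<pi> by (simp add: strong_Baxter_iff)
  qed
  then show ?thesis
    using \<pi> a length_strong_Baxter[OF assms(1)] m by (simp add: sites_def insert_right_skip)
qed

definition label :: "nat list \<Rightarrow> nat \<times> nat" where
  "label \<pi> = (card {s \<in> sites \<pi>. s \<le> last \<pi>}, card {s \<in> sites \<pi>. last \<pi> < s})"

text \<open>
  The sites of \<open>\<pi> \<cdot> a\<close> up to its last entry \<open>a\<close> are old sites with unchanged value, those above it are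
  old sites raised by one. In particular the doubled site \<open>a\<close> contributes to both groups unless the
  new pair blocks its upper copy.
\<close>

lemma label_insert_right:
  assumes \<pi>: "\<pi> \<in> strong_Baxter n" and n: "1 \<le> n" and a: "a \<in> sites \<pi>"
  shows "label (\<pi> \<cdot> a) =
    (if a < last \<pi> then (card {s \<in> sites \<pi>. s \<le> a}, snd (label \<pi>))
     else if a = last \<pi> then (fst (label \<pi>), snd (label \<pi>) + 1)
     else (fst (label \<pi>) + 1, card {s \<in> sites \<pi>. a \<le> s}))"
proof -
  let ?p = "last \<pi>"
  have len: "length \<pi> = n" using \<pi> by (rule length_strong_Baxter)
  have perm: "\<pi> \<in> permutations_of_set {1..n}" using \<pi> by (simp add: strong_Baxter_iff)
  have a': "a \<in> {1..n + 1}" using a len by (simp add: sites_def)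
  have p: "?p \<in> {1..n}"
    using perm n last_in_set[of \<pi>] len by (force simp: permutations_of_set_def)
  have last: "last (\<pi> \<cdot> a) = a" by (simp add: insert_right_skip)
  have site: "b \<in> sites (\<pi> \<cdot> a) \<longleftrightarrow> b \<in> {1..n + 2} \<and> \<not> blocked \<pi> (unskip a b) \<and>
      \<not> (a < ?p \<and> a < b \<and> b \<le> ?p + 1) \<and> \<not> (?p < b \<and> b < a)" for b
    using blocked_insert_right[OF perm n a', of b] len
    by (auto simp: sites_def insert_right_skip)
  have site_\<pi>: "s \<in> sites \<pi> \<longleftrightarrow> s \<in> {1..n + 1} \<and> \<not> blocked \<pi> s" for s
    by (simp add: sites_def len)
  have nb: "\<not> blocked \<pi> a" using a by (simp add: site_\<pi>)
  have above: "{b \<in> sites (\<pi> \<cdot> a). a < b} = Suc ` {s \<in> sites \<pi>. a \<le> s \<and> (a < ?p \<longrightarrow> ?p < s)}"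
    (is "?L = ?R")
  proof
    show "?L \<subseteq> ?R"
    proof
      fix b assume "b \<in> ?L"
      then have "b = Suc (b - 1)" "b - 1 \<in> {s \<in> sites \<pi>. a \<le> s \<and> (a < ?p \<longrightarrow> ?p < s)}"
        using a' p by (auto simp: site site_\<pi> unskip_def)
      then show "b \<in> ?R" by blast
    qed
    show "?R \<subseteq> ?L"
      using a' p by (auto simp: site site_\<pi> unskip_def)
  qed
  have below: "{b \<in> sites (\<pi> \<cdot> a). b \<le> a} =
      (if a \<le> ?p then {s \<in> sites \<pi>. s \<le> a} else insert a {s \<in> sites \<pi>. s \<le> ?p})"
    using a' p nb by (auto simp: site site_\<pi> unskip_def)
  have label: "label (\<pi> \<cdot> a) =
      (card (if a \<le> ?p then {s \<in> sites \<pi>. s \<le> a} else insert a {s \<in> sites \<pi>. s \<le> ?p}),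
       card {s \<in> sites \<pi>. a \<le> s \<and> (a < ?p \<longrightarrow> ?p < s)})"
    by (simp add: label_def last above below card_image)
  consider "a < ?p" | "a = ?p" | "?p < a" by linarith
  then show ?thesis
  proof cases
    case 1
    then have "{s \<in> sites \<pi>. a \<le> s \<and> (a < ?p \<longrightarrow> ?p < s)} = {s \<in> sites \<pi>. ?p < s}" by auto
    with 1 show ?thesis unfolding label by (simp add: label_def)
  next
    case 2
    then have "{s \<in> sites \<pi>. a \<le> s \<and> (a < ?p \<longrightarrow> ?p < s)} = insert a {s \<in> sites \<pi>. ?p < s}"
      using a by auto
    with 2 show ?thesis unfolding label by (simp add: label_def)
  next
    case 3
    then have "{s \<in> sites \<pi>. a \<le> s \<and> (a < ?p \<longrightarrow> ?p < s)} = {s \<in> sites \<pi>. a \<le> s}" by auto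
    with 3 show ?thesis unfolding label by (simp add: label_def)
  qed
qed

lemma map_card_le_sorted:
  fixes xs :: "'a :: linorder list"
  assumes "sorted_wrt (<) xs"
  shows "map (\<lambda>a. card {s \<in> set xs. s \<le> a}) xs = [1..<length xs + 1]"
  using assms
proof (induction xs rule: rev_induct)
  case (snoc x xs)
  have lt: "\<And>y. y \<in> set xs \<Longrightarrow> y < x" using snoc.prems by (simp add: sorted_wrt_append)
  have "{s \<in> set (xs @ [x]). s \<le> a} = {s \<in> set xs. s \<le> a}" if "a \<in> set xs" for a
    using lt[OF that] by auto
  moreover have "{s \<in> set (xs @ [x]). s \<le> x} = set (xs @ [x])" using lt by force
  moreover have "card (set (xs @ [x])) = length xs + 1"
    using distinct_card[of "xs @ [x]"] snoc.prems strict_sorted_iff[of "xs @ [x]"] by simp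
  ultimately show ?case using snoc by (simp add: sorted_wrt_append cong: map_cong)
qed simp

lemma map_card_ge_sorted:
  fixes xs :: "'a :: linorder list"
  assumes "sorted_wrt (<) xs"
  shows "map (\<lambda>a. card {s \<in> set xs. a \<le> s}) (rev xs) = [1..<length xs + 1]"
  using assms
proof (induction xs)
  case (Cons x xs)
  have "{s \<in> set (x # xs). a \<le> s} = {s \<in> set xs. a \<le> s}" if "a \<in> set xs" for a
    using Cons.prems that by auto
  then have "map (\<lambda>a. card {s \<in> set (x # xs). a \<le> s}) (rev xs) =
      map (\<lambda>a. card {s \<in> set xs. a \<le> s}) (rev xs)"
    by (intro map_cong refl) (simp only: set_rev)
  also have "\<dots> = [1..<length xs + 1]" using Cons by simp
  finally have "map (\<lambda>a. card {s \<in> set (x # xs). a \<le> s}) (rev xs) = [1..<length xs + 1]" .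
  moreover have "{s \<in> set (x # xs). x \<le> s} = set (x # xs)" using Cons.prems by force
  moreover have "card (set (x # xs)) = length xs + 1"
    using distinct_card[of "x # xs"] Cons.prems strict_sorted_iff[of "x # xs"] by simp
  ultimately show ?case by (simp only: rev.simps map_append list.map) simp
qed simp

text \<open>
  To match the order of the rule, the sites below the last entry are listed upwards, then the last
  entry, then the sites above it downwards: for the latter, a lower insertion keeps more upper sites.
\<close>

lemma children_labels:
  assumes \<pi>: "\<pi> \<in> strong_Baxter n" and n: "1 \<le> n"
  shows "\<exists>as. distinct as \<and> set as = sites \<pi> \<and>
    map (\<lambda>a. label (\<pi> \<cdot> a)) as = snd Omega_strong (label \<pi>)"
proof -
  let ?p = "last \<pi>"
  define lo where "lo = sorted_list_of_set {s \<in> sites \<pi>. s < ?p}"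
  define up where "up = sorted_list_of_set {s \<in> sites \<pi>. ?p < s}"
  have lo: "set lo = {s \<in> sites \<pi>. s < ?p}" "sorted_wrt (<) lo" "distinct lo"
    by (simp_all add: lo_def)
  have up: "set up = {s \<in> sites \<pi>. ?p < s}" "sorted_wrt (<) up" "distinct up"
    by (simp_all add: up_def)
  have p: "?p \<in> sites \<pi>" using \<pi> n by (rule last_site)
  have "{s \<in> sites \<pi>. s \<le> ?p} = insert ?p (set lo)" 
    using p by (auto simp: lo(1))
  then have h: "fst (label \<pi>) = length lo + 1"
    using distinct_card[OF lo(3)] by (simp add: label_def lo(1))
  have k: "snd (label \<pi>) = length up"
    using distinct_card[OF up(3)] by (simp add: label_def up(1))
  let ?as = "lo @ [?p] @ rev up"
  have "map (\<lambda>a. label (\<pi> \<cdot> a)) lo =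
      map (\<lambda>i. (i, length up)) (map (\<lambda>a. card {s \<in> set lo. s \<le> a}) lo)"
  proof -
    have "{s \<in> sites \<pi>. s \<le> a} = {s \<in> set lo. s \<le> a}" if "a \<in> set lo" for a
      using that by (auto simp: lo(1))
    moreover have "label (\<pi> \<cdot> a) = (card {s \<in> sites \<pi>. s \<le> a}, length up)" if "a \<in> set lo" for a
      using that label_insert_right[OF \<pi> n, of a] k by (simp add: lo(1))
    ultimately show ?thesis by simp
  qed
  moreover have "label (\<pi> \<cdot> ?p) = (length lo + 1, length up + 1)"
    using label_insert_right[OF \<pi> n p] h k by simp
  moreover have "map (\<lambda>a. label (\<pi> \<cdot> a)) (rev up) =
      map (\<lambda>i. (length lo + 2, i)) (map (\<lambda>a. card {s \<in> set up. a \<le> s}) (rev up))"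
  proof -
    have "{s \<in> sites \<pi>. a \<le> s} = {s \<in> set up. a \<le> s}" if "a \<in> set up" for a
      using that by (auto simp: up(1))
    moreover have "label (\<pi> \<cdot> a) = (length lo + 2, card {s \<in> sites \<pi>. a \<le> s})"
      if "a \<in> set up" for a
      using that label_insert_right[OF \<pi> n, of a] h by (simp add: up(1))
    ultimately show ?thesis by simp
  qed
  ultimately have "map (\<lambda>a. label (\<pi> \<cdot> a)) ?as =
      map (\<lambda>i. (i, length up)) [1..<length lo + 1] @ [(length lo + 1, length up + 1)] @
      map (\<lambda>i. (length lo + 2, i)) [1..<length up + 1]"
    by (simp only: map_append map_card_le_sorted[OF lo(2)] map_card_ge_sorted[OF up(2)] list.map)
  also have "\<dots> = snd Omega_strong (label \<pi>)"
    using h k by (simp add: Omega_strong_def prod.case_eq_if)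
  finally show ?thesis
    using lo(3) up(3) p by (intro exI[of _ ?as]) (auto simp: lo(1) up(1))
qed

section \<open>The tree of strong-Baxter permutations\<close>

lemma strong_Baxter_tree_simps [simp]:
  "verts strong_Baxter_tree = (\<Union>n\<in>{1..}. strong_Baxter n)"
  "rt strong_Baxter_tree = [1]"
  by (simp_all add: strong_Baxter_tree_def)

lemma edge_strong_Baxter_treeE:
  assumes "(\<pi>, \<rho>) \<in> edges strong_Baxter_tree"
  obtains n a where "1 \<le> n" "\<pi> \<in> strong_Baxter n" "a \<in> {1..n + 1}" "\<rho> = \<pi> \<cdot> a"
    "\<rho> \<in> strong_Baxter (n + 1)"
  using assms unfolding strong_Baxter_tree_def rtree.simps by blast

lemma edges_strong_Baxter_tree:
  assumes \<pi>: "\<pi> \<in> strong_Baxter n" and n: "1 \<le> n"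
  shows "(\<pi>, \<rho>) \<in> edges strong_Baxter_tree \<longleftrightarrow> (\<exists>a \<in> sites \<pi>. \<rho> = \<pi> \<cdot> a)"
proof
  assume "(\<pi>, \<rho>) \<in> edges strong_Baxter_tree"
  then show "\<exists>a \<in> sites \<pi>. \<rho> = \<pi> \<cdot> a"
    by (rule edge_strong_Baxter_treeE) (use insert_right_strong_Baxter_iff in blast)
next
  assume "\<exists>a \<in> sites \<pi>. \<rho> = \<pi> \<cdot> a"
  then obtain a where a: "a \<in> sites \<pi>" "\<rho> = \<pi> \<cdot> a" by blast
  then have "a \<in> {1..n + 1}" using length_strong_Baxter[OF \<pi>] by (simp add: sites_def)
  then show "(\<pi>, \<rho>) \<in> edges strong_Baxter_tree"
    using a \<pi> n insert_right_strong_Baxter_iff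
    unfolding strong_Baxter_tree_def rtree.simps by blast
qed

lemma strong_Baxter_1: "strong_Baxter 1 = {[1]}"
  by (auto simp: strong_Baxter_def avoids_2_41_3_def avoids_3_14_2_def avoids_3_41_2_def)

lemma relpow_strong_Baxter_tree:
  "([1], \<pi>) \<in> edges strong_Baxter_tree ^^ m \<longleftrightarrow> \<pi> \<in> strong_Baxter (Suc m)"
proof (induction m arbitrary: \<pi>)
  case 0
  then show ?case using strong_Baxter_1 by auto
next
  case (Suc m)
  show ?case
  proof
    assume "([1], \<pi>) \<in> edges strong_Baxter_tree ^^ Suc m"
    then obtain \<rho> where \<rho>: "\<rho> \<in> strong_Baxter (Suc m)" "(\<rho>, \<pi>) \<in> edges strong_Baxter_tree"
      using Suc by auto
    from \<rho>(2) obtain n where n: "\<rho> \<in> strong_Baxter n" "\<pi> \<in> strong_Baxter (n + 1)"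
      by (rule edge_strong_Baxter_treeE)
    then have "n = Suc m" using length_strong_Baxter \<rho>(1) by blast
    then show "\<pi> \<in> strong_Baxter (Suc (Suc m))" using n by simp
  next
    assume "\<pi> \<in> strong_Baxter (Suc (Suc m))"
    then obtain \<rho> a where \<rho>: "\<pi> = \<rho> \<cdot> a" "\<rho> \<in> strong_Baxter (Suc m)" "a \<in> sites \<rho>"
      using insert_right_cases[of \<pi> "Suc m"] unfolding Suc_eq_plus1 by blast
    then have "(\<rho>, \<pi>) \<in> edges strong_Baxter_tree"
      using edges_strong_Baxter_tree[of \<rho> "Suc m"] by auto
    then show "([1], \<pi>) \<in> edges strong_Baxter_tree ^^ Suc m" using Suc \<rho> by auto
  qed
qed

lemma rooted_tree_strong_Baxter_tree: "rooted_tree strong_Baxter_tree"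
proof -
  have reach: "([1], \<pi>) \<in> (edges strong_Baxter_tree)\<^sup>*" if "\<pi> \<in> strong_Baxter n" "1 \<le> n" for \<pi> n
    using that relpow_strong_Baxter_tree[of \<pi> "n - 1"] by (simp add: relpow_imp_rtrancl)
  have parent: "\<exists>!u. (u, \<pi>) \<in> edges strong_Baxter_tree"
    if "\<pi> \<in> strong_Baxter n" "1 \<le> n" "\<pi> \<noteq> [1]" for \<pi> n
  proof -
    have "([1], \<pi>) \<in> (edges strong_Baxter_tree)\<^sup>*" using reach that by blast
    then obtain u where "(u, \<pi>) \<in> edges strong_Baxter_tree"
      using \<open>\<pi> \<noteq> [1]\<close> rtranclE by metis
    moreover have "u' = u"
      if u': "(u', \<pi>) \<in> edges strong_Baxter_tree" and u: "(u, \<pi>) \<in> edges strong_Baxter_tree" for u u'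
    proof -
      obtain a where "\<pi> = u \<cdot> a" using u by (rule edge_strong_Baxter_treeE)
      moreover obtain a' where "\<pi> = u' \<cdot> a'" using u' by (rule edge_strong_Baxter_treeE)
      ultimately show ?thesis by simp
    qed
    ultimately show ?thesis by blast
  qed
  have no_parent: "(u, [1]) \<notin> edges strong_Baxter_tree" for u
  proof
    assume "(u, [1]) \<in> edges strong_Baxter_tree"
    then obtain n where "1 \<le> n" "[1] \<in> strong_Baxter (n + 1)"
      by (rule edge_strong_Baxter_treeE)
    then show False using length_strong_Baxter[of "[1]" "n + 1"] by simp
  qed
  have sub: "edges strong_Baxter_tree \<subseteq> verts strong_Baxter_tree \<times> verts strong_Baxter_tree"
  proof (rule subrelI)
    fix \<pi> \<rho> assume "(\<pi>, \<rho>) \<in> edges strong_Baxter_tree"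
    then obtain n where "1 \<le> n" "\<pi> \<in> strong_Baxter n" "\<rho> \<in> strong_Baxter (n + 1)"
      by (rule edge_strong_Baxter_treeE)
    then show "(\<pi>, \<rho>) \<in> verts strong_Baxter_tree \<times> verts strong_Baxter_tree" by auto
  qed
  have "[1] \<in> verts strong_Baxter_tree" using strong_Baxter_1 by force
  moreover have "\<exists>!u. (u, v) \<in> edges strong_Baxter_tree"
    if "v \<in> verts strong_Baxter_tree - {[1]}" for v
    using that parent by (elim DiffE) (simp only: strong_Baxter_tree_simps, blast)
  moreover have "([1], v) \<in> (edges strong_Baxter_tree)\<^sup>*" if "v \<in> verts strong_Baxter_tree" for v
    using that reach by (simp only: strong_Baxter_tree_simps) blast
  ultimately show ?thesis
    unfolding rooted_tree_def strong_Baxter_tree_simps(2) using no_parent sub by blast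
qed

lemma strong_Baxter_nonempty: "strong_Baxter (Suc m) \<noteq> {}"
proof (induction m)
  case 0
  then show ?case using strong_Baxter_1 by simp
next
  case (Suc m)
  then obtain \<pi> where "\<pi> \<in> strong_Baxter (Suc m)" by blast
  then have "\<pi> \<cdot> (Suc m + 1) \<in> strong_Baxter (Suc m + 1)"
    using top_site insert_right_strong_Baxter_iff by simp
  then show ?case by auto
qed

lemma infinite_strong_Baxter: "infinite (\<Union>n\<in>{1..}. strong_Baxter n)"
proof
  assume "finite (\<Union>n\<in>{1..}. strong_Baxter n)"
  then have "finite (length ` (\<Union>n\<in>{1..}. strong_Baxter n))" by simp
  moreover have "{1..} \<subseteq> length ` (\<Union>n\<in>{1..}. strong_Baxter n)"
  proof
    fix n :: nat assume n: "n \<in> {1..}"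
    then obtain \<pi> where "\<pi> \<in> strong_Baxter n"
      using strong_Baxter_nonempty[of "n - 1"] by auto
    with n show "n \<in> length ` (\<Union>n\<in>{1..}. strong_Baxter n)"
      using length_strong_Baxter by force
  qed
  ultimately show False using infinite_Ici finite_subset by blast
qed

lemma generating_tree_strong_Baxter: "generating_tree strong_Baxter strong_Baxter_tree"
proof -
  have "level strong_Baxter_tree n = strong_Baxter n" if "1 \<le> n" for n
  proof -
    obtain m where "n = Suc m" using \<open>1 \<le> n\<close> by (cases n) auto
    then show ?thesis
      using \<open>1 \<le> n\<close>
      by (auto simp only: level_def strong_Baxter_tree_simps relpow_strong_Baxter_tree)
  qed
  then show ?thesis
    unfolding generating_tree_def
    using rooted_tree_strong_Baxter_tree infinite_strong_Baxter by simp
qed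

theorem proposition23:
  shows "generating_tree strong_Baxter strong_Baxter_tree \<and>
         rtree_isomorphic strong_Baxter_tree (rule_tree Omega_strong)"
proof
  show "generating_tree strong_Baxter strong_Baxter_tree"
    by (rule generating_tree_strong_Baxter)
  show "rtree_isomorphic strong_Baxter_tree (rule_tree Omega_strong)"
  proof (rule rtree_isomorphic_rule_tree)
    show "rooted_tree strong_Baxter_tree" by (rule rooted_tree_strong_Baxter_tree)
    have "sites [1] = {1, 2}" by (auto simp: sites_def blocked_def)
    then have "{s \<in> sites [1]. s \<le> 1} = {1}" "{s \<in> sites [1]. 1 < s} = {2}" by auto
    then show "label (rt strong_Baxter_tree) = fst Omega_strong"
      by (simp add: label_def Omega_strong_def)
    fix \<pi> assume "\<pi> \<in> verts strong_Baxter_tree"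
    then obtain n where \<pi>: "\<pi> \<in> strong_Baxter n" "1 \<le> n" by auto
    then obtain as where as: "distinct as" "set as = sites \<pi>"
        "map (\<lambda>a. label (\<pi> \<cdot> a)) as = snd Omega_strong (label \<pi>)"
      using children_labels by blast
    show "\<exists>cs. distinct cs \<and> set cs = {c. (\<pi>, c) \<in> edges strong_Baxter_tree} \<and>
        map label cs = snd Omega_strong (label \<pi>)"
      using as edges_strong_Baxter_tree[OF \<pi>]
      by (intro exI[of _ "map (\<lambda>a. \<pi> \<cdot> a) as"]) (auto simp: distinct_map inj_on_def o_def)
  qed
qed

end
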